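(* Let $n,p,m\ge 1$ be integers, let $\boldsymbol{a}_1,\dots,\boldsymbol{a}_m\in\mathbb{C}^n$, let $\boldsymbol{b}\in\mathbb{R}^m$, $\lambda\ge 0$, and let $f_0$ be either the least-squares or the Poisson data fidelity function (see context). Let $\boldsymbol{Y}\in\mathbb{C}^{n\times p}$ be a stationary point of the nonconvex problem $$\min_{\boldsymbol{Y}\in\mathbb{C}^{n\times p}}\ f_0(\boldsymbol{Y}\boldsymbol{Y}^* )+\lambda\|\boldsymbol{Y}\|_F^2 .$$ If the matrix $$\boldsymbol{S}_{\boldsymbol{Y}}=\nabla_{\boldsymbol{X}}f_0(\boldsymbol{Y}\boldsymbol{Y}^* )+\lambda\boldsymbol{I}$$ is positive semidefinite, then $\boldsymbol{Y}\boldsymbol{Y}^*$ is a global minimizer of the convex problem $$\min_{\boldsymbol{X}\in\mathbb{H}^n}\ f_0(\boldsymbol{X})+\lambda\operatorname{Tr}(\boldsymbol{X})\quad\text{subject to}\quad \boldsymbol{X}\succeq 0 .$$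
   Context: $\mathbb{H}^n$ is the real vector space of $n\times n$ complex Hermitian matrices; $\{\cdot\}^*$ is the conjugate transpose; $\|\cdot\|_F$ is the Frobenius norm; $\boldsymbol{X}\succeq 0$ means $\boldsymbol{X}$ is Hermitian positive semidefinite. The inner product is $\langle \boldsymbol{U},\boldsymbol{V}\rangle=\operatorname{Re}(\operatorname{Tr}(\boldsymbol{U}^*\boldsymbol{V}))$, used both on $\mathbb{H}^n$ and on $\mathbb{C}^{n\times p}$. Put $\boldsymbol{A}_i=\boldsymbol{a}_i\boldsymbol{a}_i^*$ and $\mathcal{A}:\mathbb{H}^n\to\mathbb{R}^m$, $\mathcal{A}(\boldsymbol{X})=[\operatorname{Tr}(\boldsymbol{A}_1\boldsymbol{X}),\dots,\operatorname{Tr}(\boldsymbol{A}_m\boldsymbol{X})]^T$. The data fidelity function $f_0$ is one of: (i) least squares: $f_0(\boldsymbol{X})=\frac{1}{2m}\|\mathcal{A}(\boldsymbol{X})-\boldsymbol{b}\|^2$; (ii) Poisson likelihood: $f_0(\boldsymbol{X})=\sum_{i=1}^m\big(\operatorname{Tr}(\boldsymbol{A}_i\boldsymbol{X})-b_i\log(\operatorname{Tr}(\boldsymbol{A}_i\boldsymbol{X}))\big)$, where all $b_i\ge 0$. The term with $b_i=0$ is just $\operatorname{Tr}(\boldsymbol{A}_i\boldsymbol{X})$, and $f_0$ is considered on its domain, the open set of $\boldsymbol{X}\in\mathbb{H}^n$ with $\operatorname{Tr}(\boldsymbol{A}_i\boldsymbol{X})>0$ for all $i$ with $b_i>0$ (so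 both problems are over points in this domain). The gradient $\nabla_{\boldsymbol{X}}f_0(\boldsymbol{X}_0)\in\mathbb{H}^n$ is characterized by $D_{\boldsymbol{X}}f_0(\boldsymbol{X}_0)[\boldsymbol{Z}]=\lim_{t\to 0}\frac{f_0(\boldsymbol{X}_0+t\boldsymbol{Z})-f_0(\boldsymbol{X}_0)}{t}=\langle\nabla_{\boldsymbol{X}}f_0(\boldsymbol{X}_0),\boldsymbol{Z}\rangle$ for all $\boldsymbol{Z}\in\mathbb{H}^n$ ($t$ real). Likewise, for a real-valued function $\tilde f$ on $\mathbb{C}^{n\times p}$, $\nabla_{\boldsymbol{Y}}\tilde f(\boldsymbol{Y})\in\mathbb{C}^{n\times p}$ is characterized by $D_{\boldsymbol{Y}}\tilde f(\boldsymbol{Y})[\boldsymbol{Z}]=\langle\nabla_{\boldsymbol{Y}}\tilde f(\boldsymbol{Y}),\boldsymbol{Z}\rangle$ for all $\boldsymbol{Z}\in\mathbb{C}^{n\times p}$. A stationary point is a point where this gradient vanishes. *)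

theory Defs
  imports "HOL-Analysis.Analysis"
begin

text \<open>An \<open>r \<times> c\<close> complex matrix is an element of \<open>complex^'c^'r\<close>. All vector space structure
  is taken over the reals.\<close>

definition ctransp :: "complex^'c^'r \<Rightarrow> complex^'r^'c"
  where "ctransp U = (\<chi> i j. cnj (U $ j $ i))"

definition hermitian_mats :: "(complex^'n^'n) set"
  where "hermitian_mats = {X. ctransp X = X}"

text \<open>For Hermitian \<open>X\<close> the number \<open>v\<^sup>* X v\<close> is real, so taking its real part loses nothing.\<close>

definition psd :: "complex^'n^'n \<Rightarrow> bool"
  where "psd X \<longleftrightarrow> X \<in> hermitian_mats \<and>
    (\<forall>v. 0 \<le> Re (\<Sum>i\<in>UNIV. cnj (v $ i) * (X *v v) $ i))"

definition mat_inner :: "complex^'c^'r \<Rightarrow> complex^'c^'r \<Rightarrow> real"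
  where "mat_inner U V = Re (trace (ctransp U ** V))"

lemma mat_inner_eq_inner: "mat_inner U V = U \<bullet> V"
  for U V :: "complex^'c^'r"
proof -
  have "mat_inner U V = (\<Sum>j\<in>UNIV. \<Sum>i\<in>UNIV. U $ i $ j \<bullet> V $ i $ j)"
    by (simp add: mat_inner_def trace_def ctransp_def matrix_matrix_mult_def inner_complex_def)
  also have "\<dots> = U \<bullet> V"
    by (subst sum.swap) (simp add: inner_vec_def)
  finally show ?thesis .
qed

text \<open>Consequently the library's \<open>norm\<close> on matrices is the Frobenius norm.\<close>

lemma norm_eq_frobenius: "norm U = sqrt (\<Sum>i\<in>UNIV. \<Sum>j\<in>UNIV. (cmod (U $ i $ j))\<^sup>2)"
  for U :: "complex^'c^'r"
  by (simp add: norm_vec_def L2_set_def sum_nonneg)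

text \<open>\<open>G\<close> is the gradient at \<open>X0\<close> of \<open>f\<close>, viewed as a function on the real subspace \<open>V\<close>
  (all Hermitian matrices, or all \<open>n \<times> p\<close> matrices).\<close>

definition has_gradient_on ::
  "(complex^'c^'r) set \<Rightarrow> (complex^'c^'r \<Rightarrow> real) \<Rightarrow> complex^'c^'r \<Rightarrow> complex^'c^'r \<Rightarrow> bool"
  where "has_gradient_on V f X0 G \<longleftrightarrow> G \<in> V \<and>
    (\<forall>Z\<in>V. ((\<lambda>t::real. (f (X0 + t *\<^sub>R Z) - f X0) / t) \<longlongrightarrow> mat_inner G Z) (at 0))"

definition gradient_on ::
  "(complex^'c^'r) set \<Rightarrow> (complex^'c^'r \<Rightarrow> real) \<Rightarrow> complex^'c^'r \<Rightarrow> complex^'c^'r"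
  where "gradient_on V f X0 = (THE G. has_gradient_on V f X0 G)"

lemma gradient_on_eqI:
  assumes V: "subspace V" and G: "has_gradient_on V f X0 G"
  shows "gradient_on V f X0 = G"
  unfolding gradient_on_def
proof (rule the_equality)
  show "has_gradient_on V f X0 G" by (fact G)
next
  fix H assume H: "has_gradient_on V f X0 H"
  then have D: "H - G \<in> V"
    using G V by (simp add: has_gradient_on_def subspace_diff)
  have "mat_inner H (H - G) = mat_inner G (H - G)"
    using G H D unfolding has_gradient_on_def by (meson LIM_unique)
  then have "(H - G) \<bullet> (H - G) = 0"
    by (simp add: mat_inner_eq_inner inner_diff_left)
  then show "H = G" by simp
qed

lemma subspace_hermitian_mats: "subspace (hermitian_mats :: (complex^'n^'n) set)"
  by (auto simp: subspace_def hermitian_mats_def ctransp_def vec_eq_iff)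

definition outer :: "complex^'n \<Rightarrow> complex^'n^'n"
  where "outer v = (\<chi> j k. v $ j * cnj (v $ k))"

text \<open>The traces below are real for Hermitian \<open>X\<close>, so taking real parts loses nothing.\<close>

definition measure_op :: "('m \<Rightarrow> complex^'n) \<Rightarrow> complex^'n^'n \<Rightarrow> real^'m"
  where "measure_op a X = (\<chi> i. Re (trace (outer (a i) ** X)))"

datatype fidelity = Least_Squares | Poisson

text \<open>For \<open>b $ i = 0\<close> the logarithmic term vanishes, whatever the value of \<open>ln\<close> is.
  The value of the Poisson fidelity is meaningful only on \<open>fidelity_domain\<close> below.\<close>

fun fidelity_fun ::
  "fidelity \<Rightarrow> ('m::finite \<Rightarrow> complex^'n) \<Rightarrow> real^'m \<Rightarrow> complex^'n^'n \<Rightarrow> real"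
  where
    "fidelity_fun Least_Squares a b X =
       1 / (2 * real CARD('m)) * (norm (measure_op a X - b))\<^sup>2"
  | "fidelity_fun Poisson a b X =
       (\<Sum>i\<in>UNIV. measure_op a X $ i - b $ i * ln (measure_op a X $ i))"

fun fidelity_domain ::
  "fidelity \<Rightarrow> ('m::finite \<Rightarrow> complex^'n) \<Rightarrow> real^'m \<Rightarrow> (complex^'n^'n) set"
  where
    "fidelity_domain Least_Squares a b = hermitian_mats"
  | "fidelity_domain Poisson a b =
       {X \<in> hermitian_mats. \<forall>i. b $ i > 0 \<longrightarrow> measure_op a X $ i > 0}"

definition convex_objective ::
  "fidelity \<Rightarrow> ('m::finite \<Rightarrow> complex^'n) \<Rightarrow> real^'m \<Rightarrow> real \<Rightarrow> complex^'n^'n \<Rightarrow> real"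
  where "convex_objective k a b lam X = fidelity_fun k a b X + lam * Re (trace X)"

definition factored_objective ::
  "fidelity \<Rightarrow> ('m::finite \<Rightarrow> complex^'n) \<Rightarrow> real^'m \<Rightarrow> real \<Rightarrow> complex^'p^'n \<Rightarrow> real"
  where "factored_objective k a b lam Y =
    fidelity_fun k a b (Y ** ctransp Y) + lam * (norm Y)\<^sup>2"

definition stationary_point ::
  "fidelity \<Rightarrow> ('m::finite \<Rightarrow> complex^'n) \<Rightarrow> real^'m \<Rightarrow> real \<Rightarrow> complex^'p^'n \<Rightarrow> bool"
  where "stationary_point k a b lam Y \<longleftrightarrow>
    Y ** ctransp Y \<in> fidelity_domain k a b \<and>
    has_gradient_on UNIV (factored_objective k a b lam) Y 0"

definition S_mat ::
  "fidelity \<Rightarrow> ('m::finite \<Rightarrow> complex^'n) \<Rightarrow> real^'m \<Rightarrow> real \<Rightarrow> complex^'p^'n \<Rightarrow> complex^'n^'n"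
  where "S_mat k a b lam Y =
    gradient_on hermitian_mats (fidelity_fun k a b) (Y ** ctransp Y) + lam *\<^sub>R mat 1"

end

theory Submission
  imports Defs
begin

text \<open>The fidelity \<open>f\<^sub>0\<close> is convex, so with \<open>X\<^sub>0 = Y Y\<^sup>*\<close> the convex objective at a feasible \<open>X\<close>
  exceeds its value at \<open>X\<^sub>0\<close> by at least \<open>\<langle>S\<^sub>Y, X - X\<^sub>0\<rangle>\<close>. Stationarity is only needed in the
  radial direction \<open>Y\<close>: along \<open>(1 + t) Y\<close> the matrix \<open>X\<^sub>0\<close> is scaled by \<open>(1 + t)\<^sup>2\<close>, which gives
  \<open>2 \<langle>S\<^sub>Y, X\<^sub>0\<rangle> = 0\<close>. Finally \<open>\<langle>S\<^sub>Y, X\<rangle> \<ge> 0\<close>, as both matrices are positive semidefinite.\<close>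

section \<open>Positive semidefinite matrices\<close>

definition sesq :: "complex^'n^'n \<Rightarrow> complex^'n \<Rightarrow> complex^'n \<Rightarrow> complex"
  where "sesq X v w = (\<Sum>i\<in>UNIV. \<Sum>j\<in>UNIV. cnj (v $ i) * X $ i $ j * w $ j)"

lemma sesq_add_left: "sesq X (u + v) w = sesq X u w + sesq X v w"
  and sesq_add_right: "sesq X v (u + w) = sesq X v u + sesq X v w"
  by (simp_all add: sesq_def algebra_simps sum.distrib)

lemma sesq_axis_right: "sesq X v (axis k c) = (\<Sum>i\<in>UNIV. cnj (v $ i) * X $ i $ k) * c"
  by (simp add: sesq_def axis_def if_distrib[of "\<lambda>x. _ * x"] sum_distrib_right cong: if_cong)

lemma sesq_axis_axis: "sesq X (axis j c) (axis k d) = cnj c * X $ j $ k * d"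
  unfolding sesq_axis_right
  by (simp add: axis_def if_distrib[of cnj] if_distrib[of "\<lambda>x. x * _"] cong: if_cong)

lemma sesq_commute:
  assumes "X \<in> hermitian_mats"
  shows "sesq X w v = cnj (sesq X v w)"
proof -
  have X: "cnj (X $ i $ j) = X $ j $ i" for i j
    using assms by (auto simp: hermitian_mats_def ctransp_def vec_eq_iff)
  show ?thesis
    unfolding sesq_def by (subst sum.swap) (simp add: X mult_ac)
qed

lemma inner_outer: "X \<bullet> outer v = Re (sesq X v v)"
  by (simp add: inner_vec_def inner_complex_def outer_def sesq_def sum.distrib algebra_simps)

lemma outer_inner_outer: "outer x \<bullet> outer v = (cmod (\<Sum>i\<in>UNIV. cnj (v $ i) * x $ i))\<^sup>2"
proof -
  let ?s = "\<Sum>i\<in>UNIV. cnj (v $ i) * x $ i"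
  have "sesq (outer x) v v = ?s * cnj ?s"
    unfolding cnj_sum sum_product by (simp add: sesq_def outer_def mult_ac)
  then show ?thesis
    by (metis Re_complex_of_real complex_norm_square inner_outer)
qed

lemma outer_hermitian [simp]: "outer v \<in> hermitian_mats"
  by (simp add: hermitian_mats_def ctransp_def outer_def vec_eq_iff mult.commute)

text \<open>Positivity becomes a family of linear inequalities in the real inner product, one for
  each rank-one matrix. Pairings with sums of rank-one matrices can then be estimated term by
  term.\<close>

lemma psd_iff_inner_outer: "psd X \<longleftrightarrow> X \<in> hermitian_mats \<and> (\<forall>v. 0 \<le> X \<bullet> outer v)"
proof -
  have "(\<Sum>i\<in>UNIV. cnj (v $ i) * (X *v v) $ i) = sesq X v v" for v
    by (simp add: sesq_def matrix_vector_mult_def sum_distrib_left mult.assoc)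
  then show ?thesis by (simp add: psd_def inner_outer)
qed

lemma psd_mult_ctransp: "psd (Y ** ctransp Y)"
  for Y :: "complex^'p^'n"
proof -
  have Y: "Y ** ctransp Y = (\<Sum>k\<in>UNIV. outer (column k Y))"
    by (simp add: matrix_matrix_mult_def ctransp_def outer_def column_def vec_eq_iff)
  show ?thesis
    unfolding psd_iff_inner_outer Y
    by (auto intro!: subspace_sum subspace_hermitian_mats sum_nonneg
        simp: inner_sum_left outer_inner_outer)
qed

section \<open>Schur complements and pairings of positive semidefinite matrices\<close>

lemma psd_diagonal:
  assumes "psd X"
  shows "X $ k $ k = of_real (Re (X $ k $ k))" and "0 \<le> Re (X $ k $ k)"
proof -
  have "cnj (X $ k $ k) = X $ k $ k"
    using assms by (auto simp: psd_def hermitian_mats_def ctransp_def vec_eq_iff)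
  then show "X $ k $ k = of_real (Re (X $ k $ k))"
    by (simp add: complex_eq_iff)
  have "0 \<le> X \<bullet> outer (axis k 1)"
    using assms by (simp add: psd_iff_inner_outer)
  then show "0 \<le> Re (X $ k $ k)"
    by (simp add: inner_outer sesq_axis_axis)
qed

text \<open>The three terms come from expanding the form of \<open>X\<close> at
  \<open>v + axis k c\<close>. The scalar \<open>c\<close> stays free: one choice forces
  off-diagonal entries to vanish in \<open>psd_zero_diagonal\<close>, another completes the square
  in \<open>psd_schur_complement\<close>.\<close>

lemma psd_inner_outer_add_axis:
  assumes "psd X"
  shows "0 \<le> X \<bullet> outer v + 2 * Re ((\<Sum>i\<in>UNIV. cnj (v $ i) * X $ i $ k) * c)
    + (cmod c)\<^sup>2 * Re (X $ k $ k)"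
proof -
  have herm: "X \<in> hermitian_mats" using assms by (simp add: psd_def)
  have "0 \<le> Re (sesq X (v + axis k c) (v + axis k c))"
    using assms by (simp add: psd_iff_inner_outer flip: inner_outer)
  also have "\<dots> = Re (sesq X v v) + 2 * Re (sesq X v (axis k c))
      + Re (sesq X (axis k c) (axis k c))"
    by (simp add: sesq_add_left sesq_add_right sesq_commute[OF herm, of "axis k c" v])
  also have "Re (sesq X (axis k c) (axis k c)) = (cmod c)\<^sup>2 * Re (X $ k $ k)"
    by (subst psd_diagonal(1)[OF assms])
      (simp add: sesq_axis_axis cmod_power2, simp add: power2_eq_square algebra_simps)
  finally show ?thesis by (simp add: inner_outer sesq_axis_right)
qed

lemma psd_zero_diagonal:
  assumes "psd X" and "\<And>k. X $ k $ k = 0"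
  shows "X = 0"
proof -
  have "X $ j $ k = 0" for j k
  proof -
    have "X \<bullet> outer (axis j 1) = 0"
      by (simp add: inner_outer sesq_axis_axis assms(2))
    moreover have "(\<Sum>i\<in>UNIV. cnj (axis j 1 $ i) * X $ i $ k) = X $ j $ k"
      by (simp add: axis_def if_distrib[of cnj] if_distrib[of "\<lambda>x. x * _"] cong: if_cong)
    \<comment> \<open>With \<open>v = axis j 1\<close> and c the negative conjugate of the entry,
      both square terms vanish and only minus twice its squared modulus is left.\<close>
    ultimately have "0 \<le> Re (X $ j $ k * - cnj (X $ j $ k))"
      using psd_inner_outer_add_axis[OF assms(1), of "axis j 1" k "- cnj (X $ j $ k)"] assms(2)
      by simp
    then have "(Re (X $ j $ k))\<^sup>2 + (Im (X $ j $ k))\<^sup>2 \<le> 0"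
      by (simp add: power2_eq_square)
    then show ?thesis
      by (simp add: sum_power2_le_zero_iff complex_eq_iff)
  qed
  then show ?thesis by (simp add: vec_eq_iff)
qed

text \<open>Let d be the pivot and s = v^* X e_k. The subtracted matrix lowers the form at
  \<open>v\<close> by |s|^2 / d, which is exactly the drop obtained by minimising the form at
  \<open>v + axis k c\<close> over \<open>c\<close>. That minimum is still nonnegative.\<close>

lemma psd_schur_complement:
  assumes "psd X" and "X $ k $ k \<noteq> 0"
  shows "psd (X - inverse (Re (X $ k $ k)) *\<^sub>R outer (column k X))"
proof -
  define d where "d = Re (X $ k $ k)"
  have d: "0 < d"
    using psd_diagonal[OF assms(1), of k] assms(2) by (metis d_def less_eq_real_def of_real_0)
  have "0 \<le> (X - inverse d *\<^sub>R outer (column k X)) \<bullet> outer v" for v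
  proof -
    define s where "s = (\<Sum>i\<in>UNIV. cnj (v $ i) * X $ i $ k)"
    \<comment> \<open>The minimiser of 2 Re (s c) + |c|^2 d, with minimum -|s|^2 / d.\<close>
    define c where "c = - cnj s / of_real d"
    have "Re (s * c) = - ((cmod s)\<^sup>2 / d)"
      unfolding c_def using d
      by (simp add: cmod_power2) (simp add: power2_eq_square field_simps)
    moreover have "(cmod c)\<^sup>2 * d = (cmod s)\<^sup>2 / d"
      using d by (simp add: c_def norm_divide power2_eq_square field_simps)
    ultimately have "0 \<le> X \<bullet> outer v - (cmod s)\<^sup>2 / d"
      using psd_inner_outer_add_axis[OF assms(1), of v k c] by (simp add: s_def d_def)
    then show ?thesis
      by (simp add: inner_diff_left outer_inner_outer column_def s_def divide_inverse mult.commute)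
  qed
  then show ?thesis
    unfolding psd_iff_inner_outer d_def
    using assms(1) by (auto intro!: subspace_diff subspace_scale subspace_hermitian_mats simp: psd_def)
qed

text \<open>Repeated Schur complements split \<open>X\<close> into rank-one matrices.\<close>

lemma psd_inner_nonneg:
  assumes "psd X" and S: "\<And>v. 0 \<le> S \<bullet> outer v"
  shows "0 \<le> S \<bullet> X"
  using assms(1)
\<comment> \<open>The measure counts nonzero diagonal entries. A Schur complement at k clears entry
  k and must not create a new one.\<close>
proof (induction "card {i. X $ i $ i \<noteq> 0}" arbitrary: X rule: less_induct)
  case less
  show ?case
  proof (cases "\<forall>k. X $ k $ k = 0")
    case True
    then show ?thesis using psd_zero_diagonal[OF less.prems] by simp
  next
    case False
    then obtain k where k: "X $ k $ k \<noteq> 0" by blast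
    define d where "d = Re (X $ k $ k)"
    define X' where "X' = X - inverse d *\<^sub>R outer (column k X)"
    have X': "psd X'"
      unfolding X'_def d_def using less.prems k by (rule psd_schur_complement)
    have Xkk: "X $ k $ k = of_real d" and d: "0 < d"
      using psd_diagonal[OF less.prems, of k] k unfolding d_def
      by (simp, metis less_eq_real_def of_real_0)
    have diag: "X' $ i $ i = X $ i $ i - of_real (inverse d * (cmod (X $ i $ k))\<^sup>2)" for i
      by (simp add: X'_def outer_def column_def scaleR_conv_of_real[where 'a = complex]
          flip: complex_norm_square)
    have "X' $ k $ k = 0"
      using d by (simp only: diag Xkk) (simp add: power2_eq_square)
    \<comment> \<open>The subtraction can only lower a diagonal entry, and \<open>X'\<close> has no
      negative ones, so a zero stays zero.\<close>
    moreover have "X' $ i $ i = 0" if "X $ i $ i = 0" for i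
    proof -
      have "0 \<le> inverse d * (cmod (X $ i $ k))\<^sup>2" using d by simp
      moreover have "0 \<le> - (inverse d * (cmod (X $ i $ k))\<^sup>2)"
        using psd_diagonal(2)[OF X', of i] unfolding diag that by (simp del: of_real_mult of_real_power of_real_inverse)
      ultimately have "inverse d * (cmod (X $ i $ k))\<^sup>2 = 0" by linarith
      then show ?thesis by (simp only: diag that) simp
    qed
    ultimately have "{i. X' $ i $ i \<noteq> 0} \<subset> {i. X $ i $ i \<noteq> 0}"
      using k by blast
    then have "card {i. X' $ i $ i \<noteq> 0} < card {i. X $ i $ i \<noteq> 0}"
      by (simp add: psubset_card_mono)
    then have "0 \<le> S \<bullet> X'" using less.hyps X' by blast
    moreover have "0 \<le> inverse d * (S \<bullet> outer (column k X))"
      using d S by simp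
    ultimately show ?thesis
      unfolding X'_def by (simp add: inner_diff_right)
  qed
qed

section \<open>The fidelity functions\<close>

lemma measure_op_eq_inner: "measure_op a X $ i = outer (a i) \<bullet> X"
proof -
  have "ctransp (outer (a i)) = outer (a i)"
    using outer_hermitian by (simp add: hermitian_mats_def)
  then show ?thesis
    by (simp add: measure_op_def mat_inner_def flip: mat_inner_eq_inner)
qed

text \<open>Both fidelities are sums over the measurements of one scalar function, so
  differentiability and convexity become one-variable facts. Here \<open>m\<close> stands for the
  number of measurements and \<beta> for a single datum.\<close>

fun fid_term :: "fidelity \<Rightarrow> real \<Rightarrow> real \<Rightarrow> real \<Rightarrow> real"
  where
    "fid_term Least_Squares m \<beta> z = (z - \<beta>)\<^sup>2 / (2 * m)"
  | "fid_term Poisson m \<beta> z = z - \<beta> * ln z"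

fun fid_slope :: "fidelity \<Rightarrow> real \<Rightarrow> real \<Rightarrow> real \<Rightarrow> real"
  where
    "fid_slope Least_Squares m \<beta> z = (z - \<beta>) / m"
  | "fid_slope Poisson m \<beta> z = 1 - \<beta> / z"

lemma fidelity_fun_eq_sum:
  "fidelity_fun k a b X =
    (\<Sum>i\<in>UNIV. fid_term k (real CARD('m)) (b $ i) (measure_op a X $ i))"
  for a :: "'m::finite \<Rightarrow> complex^'n"
  by (cases k)
    (simp_all add: power2_norm_eq_inner inner_vec_def sum_divide_distrib flip: power2_eq_square)

text \<open>For \<beta> = 0 the logarithmic term is identically 0, so the derivative exists also
  where \<open>z\<close> is not positive.\<close>

lemma fid_term_has_derivative:
  assumes "k = Poisson \<Longrightarrow> \<beta> = 0 \<or> 0 < z" and "0 < m"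
  shows "(fid_term k m \<beta> has_real_derivative fid_slope k m \<beta> z) (at z)"
proof (cases k)
  case Least_Squares
  have "((\<lambda>z. (z - \<beta>)\<^sup>2 / (2 * m)) has_real_derivative (z - \<beta>) / m) (at z)"
    using assms(2) by (auto intro!: derivative_eq_intros simp: field_simps)
  moreover have "fid_term Least_Squares m \<beta> = (\<lambda>z. (z - \<beta>)\<^sup>2 / (2 * m))" by auto
  ultimately show ?thesis by (simp only: Least_Squares fid_slope.simps)
next
  case Poisson
  have "((\<lambda>z. z - \<beta> * ln z) has_real_derivative 1 - \<beta> / z) (at z)"
  proof (cases "\<beta> = 0")
    case False
    then show ?thesis
      using assms(1) Poisson by (auto intro!: derivative_eq_intros)
  qed simp
  moreover have "fid_term Poisson m \<beta> = (\<lambda>z. z - \<beta> * ln z)" by auto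
  ultimately show ?thesis by (simp only: Poisson fid_slope.simps)
qed

text \<open>For least squares the gap is the square (z - z0)^2 / (2 m). For Poisson the bound is the
  concavity of \<open>ln\<close>, multiplied by \<beta> > 0.\<close>

lemma fid_term_ge_tangent:
  assumes "k = Poisson \<Longrightarrow> \<beta> = 0 \<or> 0 < \<beta> \<and> 0 < z \<and> 0 < z0" and "0 < m"
  shows "fid_term k m \<beta> z0 + fid_slope k m \<beta> z0 * (z - z0) \<le> fid_term k m \<beta> z"
proof (cases k)
  case Least_Squares
  have "(z - \<beta>)\<^sup>2 = (z0 - \<beta>)\<^sup>2 + 2 * (z0 - \<beta>) * (z - z0) + (z - z0)\<^sup>2"
    by (simp add: power2_eq_square algebra_simps)
  then have "(z0 - \<beta>)\<^sup>2 + 2 * (z0 - \<beta>) * (z - z0) \<le> (z - \<beta>)\<^sup>2"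
    by simp
  then have "((z0 - \<beta>)\<^sup>2 + 2 * (z0 - \<beta>) * (z - z0)) / (2 * m) \<le> (z - \<beta>)\<^sup>2 / (2 * m)"
    using assms(2) by (simp add: divide_right_mono)
  moreover have "2 * (z0 - \<beta>) * (z - z0) / (2 * m) = (z0 - \<beta>) / m * (z - z0)"
    by (simp only: mult.assoc times_divide_eq_left) simp
  ultimately show ?thesis
    by (simp only: Least_Squares fid_term.simps fid_slope.simps add_divide_distrib)
next
  case Poisson
  show ?thesis
  proof (cases "\<beta> = 0")
    case False
    then have pos: "0 < \<beta>" "0 < z" "0 < z0" using assms(1) Poisson by auto
    have "\<beta> * (ln z - ln z0) \<le> \<beta> * ((z - z0) / z0)"
      using pos by (intro mult_left_mono ln_diff_le) auto
    then show ?thesis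
      by (simp add: Poisson algebra_simps)
  qed (simp add: Poisson)
qed

section \<open>Gradient and tangent inequality of the fidelity\<close>

definition fid_grad ::
  "fidelity \<Rightarrow> ('m::finite \<Rightarrow> complex^'n) \<Rightarrow> real^'m \<Rightarrow> complex^'n^'n \<Rightarrow> complex^'n^'n"
  where "fid_grad k a b X =
    (\<Sum>i\<in>UNIV. fid_slope k (real CARD('m)) (b $ i) (measure_op a X $ i) *\<^sub>R outer (a i))"

lemma fid_grad_inner:
  "fid_grad k a b X \<bullet> Z =
    (\<Sum>i\<in>UNIV. fid_slope k (real CARD('m)) (b $ i) (measure_op a X $ i) * measure_op a Z $ i)"
  for a :: "'m::finite \<Rightarrow> complex^'n"
  by (simp add: fid_grad_def inner_sum_left measure_op_eq_inner)

lemma fidelity_fun_line_derivative: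
  fixes a :: "'m::finite \<Rightarrow> complex^'n"
  assumes "k = Poisson \<Longrightarrow> \<forall>i. 0 \<le> b $ i" and "X \<in> fidelity_domain k a b"
  shows "((\<lambda>t. fidelity_fun k a b (X + t *\<^sub>R Z)) has_real_derivative fid_grad k a b X \<bullet> Z) (at 0)"
proof -
  have "((\<lambda>t. fid_term k (real CARD('m)) (b $ i) (measure_op a (X + t *\<^sub>R Z) $ i))
      has_real_derivative
        fid_slope k (real CARD('m)) (b $ i) (measure_op a X $ i) * measure_op a Z $ i) (at 0)" for i
  proof (rule DERIV_chain2[where g = "\<lambda>t. measure_op a (X + t *\<^sub>R Z) $ i"])
    \<comment> \<open>Since b is nonnegative, a nonzero datum is positive, and there the domain
      forces a positive measurement.\<close>
    have "k = Poisson \<Longrightarrow> b $ i = 0 \<or> 0 < measure_op a (X + 0 *\<^sub>R Z) $ i"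
      using assms by (cases "b $ i = 0") (auto simp: less_le)
    then show "(fid_term k (real CARD('m)) (b $ i) has_real_derivative
        fid_slope k (real CARD('m)) (b $ i) (measure_op a X $ i))
        (at (measure_op a (X + 0 *\<^sub>R Z) $ i))"
      using fid_term_has_derivative[of k "b $ i" "measure_op a X $ i" "real CARD('m)"] by simp
    show "((\<lambda>t. measure_op a (X + t *\<^sub>R Z) $ i) has_real_derivative measure_op a Z $ i) (at 0)"
      unfolding measure_op_eq_inner inner_add_right inner_scaleR_right
      by (auto intro!: derivative_eq_intros)
  qed
  then show ?thesis
    unfolding fidelity_fun_eq_sum fid_grad_inner by (intro DERIV_sum)
qed

lemma fidelity_gradient:
  assumes "k = Poisson \<Longrightarrow> \<forall>i. 0 \<le> b $ i" and "X \<in> fidelity_domain k a b"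
  shows "gradient_on hermitian_mats (fidelity_fun k a b) X = fid_grad k a b X"
proof (rule gradient_on_eqI[OF subspace_hermitian_mats])
  have "fid_grad k a b X \<in> hermitian_mats"
    unfolding fid_grad_def
    by (intro subspace_sum subspace_scale subspace_hermitian_mats outer_hermitian)
  then show "has_gradient_on hermitian_mats (fidelity_fun k a b) X (fid_grad k a b X)"
    using fidelity_fun_line_derivative[OF assms]
    by (simp add: has_gradient_on_def mat_inner_eq_inner DERIV_def)
qed

lemma fidelity_fun_ge_tangent:
  assumes "k = Poisson \<Longrightarrow> \<forall>i. 0 \<le> b $ i"
    and "X0 \<in> fidelity_domain k a b" and "X \<in> fidelity_domain k a b"
  shows "fidelity_fun k a b X0 + fid_grad k a b X0 \<bullet> (X - X0) \<le> fidelity_fun k a b X"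
proof -
  have "k = Poisson \<Longrightarrow>
      b $ i = 0 \<or> 0 < b $ i \<and> 0 < measure_op a X $ i \<and> 0 < measure_op a X0 $ i" for i
    using assms by (cases "b $ i = 0") (auto simp: less_le)
  moreover have "measure_op a (X - X0) $ i = measure_op a X $ i - measure_op a X0 $ i" for i
    by (simp add: measure_op_eq_inner inner_diff_right)
  ultimately show ?thesis
    unfolding fidelity_fun_eq_sum fid_grad_inner sum.distrib[symmetric]
    by (auto intro!: sum_mono fid_term_ge_tangent)
qed

lemma mat_1_inner: "mat 1 \<bullet> X = Re (trace X)"
  for X :: "complex^'n^'n"
proof -
  have "ctransp (mat 1 :: complex^'n^'n) = mat 1"
    by (simp add: ctransp_def mat_def vec_eq_iff)
  then show ?thesis
    by (simp add: mat_inner_def flip: mat_inner_eq_inner)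
qed

text \<open>By cyclicity of the trace, the Frobenius penalty of \<open>Y\<close> is the trace
  penalty of the matrix it factors.\<close>

lemma Re_trace_mult_ctransp: "Re (trace (Y ** ctransp Y)) = (norm Y)\<^sup>2"
  for Y :: "complex^'p^'n"
  by (metis mat_inner_def mat_inner_eq_inner power2_norm_eq_inner trace_mul_sym)

section \<open>Stationarity along Y and global optimality\<close>

lemma stationary_radial:
  assumes b: "k = Poisson \<Longrightarrow> \<forall>i. 0 \<le> b $ i" and Y: "stationary_point k a b lam Y"
  shows "(fid_grad k a b (Y ** ctransp Y) + lam *\<^sub>R mat 1) \<bullet> (Y ** ctransp Y) = 0"
proof -
  define X where "X = Y ** ctransp Y"
  have X: "X \<in> fidelity_domain k a b"
    using Y by (simp add: stationary_point_def X_def)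
  \<comment> \<open>Write (1 + t)^2 = 1 + s with s = 2 t + t^2. Then s vanishes at t = 0 with slope
    2, so the derivative of the fidelity along the line through \<open>X\<close> in direction
    \<open>X\<close> can be composed with s.\<close>
  have "(\<lambda>t. factored_objective k a b lam (Y + t *\<^sub>R Y)) =
      (\<lambda>t. fidelity_fun k a b (X + (2 * t + t\<^sup>2) *\<^sub>R X) + lam * ((1 + t)\<^sup>2 * (norm Y)\<^sup>2))"
  proof
    fix t :: real
    have YY: "Y + t *\<^sub>R Y = (1 + t) *\<^sub>R Y" by (simp add: scaleR_left_distrib)
    have "(1 + t) *\<^sub>R Y ** ctransp ((1 + t) *\<^sub>R Y) = (1 + t)\<^sup>2 *\<^sub>R X"
      by (simp add: X_def matrix_matrix_mult_def ctransp_def vec_eq_iff scaleR_sum_right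
          power2_eq_square)
    also have "\<dots> = X + (2 * t + t\<^sup>2) *\<^sub>R X"
      by (simp add: power2_eq_square algebra_simps)
    finally show "factored_objective k a b lam (Y + t *\<^sub>R Y) =
        fidelity_fun k a b (X + (2 * t + t\<^sup>2) *\<^sub>R X) + lam * ((1 + t)\<^sup>2 * (norm Y)\<^sup>2)"
      by (simp add: factored_objective_def YY power_mult_distrib)
  qed
  moreover have "((\<lambda>t. fidelity_fun k a b (X + (2 * t + t\<^sup>2) *\<^sub>R X)) has_real_derivative
      (fid_grad k a b X \<bullet> X) * 2) (at 0)"
    by (rule DERIV_chain2[where g = "\<lambda>t. 2 * t + t\<^sup>2"])
      (use fidelity_fun_line_derivative[OF b X, of X] in \<open>auto intro!: derivative_eq_intros\<close>)
  moreover have "((\<lambda>t. lam * ((1 + t)\<^sup>2 * (norm Y)\<^sup>2)) has_real_derivative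
      lam * (2 * (norm Y)\<^sup>2)) (at 0)"
    by (auto intro!: derivative_eq_intros)
  ultimately have "((\<lambda>t. factored_objective k a b lam (Y + t *\<^sub>R Y)) has_real_derivative
      (fid_grad k a b X \<bullet> X) * 2 + lam * (2 * (norm Y)\<^sup>2)) (at 0)"
    by (simp add: DERIV_add)
  moreover have "((\<lambda>t. factored_objective k a b lam (Y + t *\<^sub>R Y)) has_real_derivative 0) (at 0)"
    using Y by (simp add: stationary_point_def has_gradient_on_def mat_inner_eq_inner DERIV_def)
  ultimately have "(fid_grad k a b X \<bullet> X) * 2 + lam * (2 * (norm Y)\<^sup>2) = 0"
    by (rule DERIV_unique)
  then show ?thesis
    by (simp add: X_def inner_add_left mat_1_inner Re_trace_mult_ctransp)
qed

theorem theorem3p3: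
  fixes k :: fidelity
    and a :: "'m::finite \<Rightarrow> complex^'n"
    and b :: "real^'m"
    and lam :: real
    and Y :: "complex^'p^'n"
  assumes "k = Poisson \<Longrightarrow> \<forall>i. 0 \<le> b $ i"
    and "0 \<le> lam"
    and "stationary_point k a b lam Y"
    and "psd (S_mat k a b lam Y)"
  shows "is_arg_min (convex_objective k a b lam) (\<lambda>X. X \<in> fidelity_domain k a b \<and> psd X)
    (Y ** ctransp Y)"
proof -
  define X0 where "X0 = Y ** ctransp Y"
  define S where "S = S_mat k a b lam Y"
  have X0: "X0 \<in> fidelity_domain k a b"
    using assms(3) by (simp add: stationary_point_def X0_def)
  have S: "S = fid_grad k a b X0 + lam *\<^sub>R mat 1"
    unfolding S_def S_mat_def X0_def[symmetric]
    using fidelity_gradient[OF assms(1) X0] by simp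
  have "convex_objective k a b lam X0 \<le> convex_objective k a b lam X"
    if X: "X \<in> fidelity_domain k a b" "psd X" for X
  proof -
    have "0 \<le> S \<bullet> X"
      using X(2) assms(4) unfolding psd_iff_inner_outer[of "S_mat k a b lam Y"] S_def
      by (blast intro: psd_inner_nonneg)
    moreover have "S \<bullet> X0 = 0"
      using stationary_radial[OF assms(1,3)] by (simp add: S X0_def)
    ultimately have "0 \<le> S \<bullet> (X - X0)" by (simp add: inner_diff_right)
    \<comment> \<open>The pairing splits into the linearised change of the fidelity, bounded by the
      tangent inequality, and the exact change of the trace penalty.\<close>
    also have "\<dots> = fid_grad k a b X0 \<bullet> (X - X0) + lam * (Re (trace X) - Re (trace X0))"
      by (simp add: S inner_add_left inner_diff_right mat_1_inner right_diff_distrib)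
    finally show ?thesis
      using fidelity_fun_ge_tangent[OF assms(1) X0 X(1)]
      by (simp add: convex_objective_def right_diff_distrib)
  qed
  \<comment> \<open>\<open>is_arg_min\<close> also asks that the candidate itself be
    feasible.\<close>
  then show ?thesis
    using X0 psd_mult_ctransp[of Y]
    by (auto simp: is_arg_min_def X0_def not_less)
qed

end
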